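(* Let $\varphi$ and $\psi$ be bounded analytic functions on the open unit disc $\mathbb{U}$. If $\partial\varphi(\mathbb{U})$ consists entirely of nondegenerate continua, then $T_\varphi\propto T_\psi$ implies $\psi(\mathbb{U})\subset\varphi(\mathbb{U})$.
   Context: $\mathbb{U}$ is the open unit disc in $\mathbb{C}$ and $H^2$ is the Hardy space of $\mathbb{U}$. For a bounded analytic function $\varphi$ on $\mathbb{U}$, $T_\varphi:H^2\to H^2$ is the analytic Toeplitz operator $T_\varphi h=\varphi h$. For bounded linear operators $A,B$ on a Hilbert space $\mathcal{H}$, $A\propto B$ means that there is a nonzero bounded linear operator $X$ on $\mathcal{H}$ with $XA=BX$. A nondegenerate continuum is a compact connected set with more than one point; "$\partial\varphi(\mathbb{U})$ consists entirely of nondegenerate continua" means that $\partial\varphi(\mathbb{U})$ (boundary in $\mathbb{C}$) is a union of nondegenerate continua. *)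

theory Defs
  imports "HOL-Complex_Analysis.Complex_Analysis"
begin

definition circle_mean2 :: "(complex \<Rightarrow> complex) \<Rightarrow> real \<Rightarrow> real" where
  "circle_mean2 f r =
     integral {0..2*pi} (\<lambda>t. (cmod (f (complex_of_real r * cis t)))\<^sup>2) / (2*pi)"

text \<open>Elements of the Hardy space are total functions on the complex plane; requiring the
  value 0 off the disc makes equality of elements the same as equality on the disc, so that
  the linear structure is the pointwise one.\<close>

definition hardy2 :: "(complex \<Rightarrow> complex) set" where
  "hardy2 = {f. f holomorphic_on ball 0 1 \<and> (\<forall>z. z \<notin> ball 0 1 \<longrightarrow> f z = 0) \<and>
                bdd_above (circle_mean2 f ` {0..<1})}"

definition hardy2_norm :: "(complex \<Rightarrow> complex) \<Rightarrow> real" where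
  "hardy2_norm f = sqrt (SUP r\<in>{0..<1}. circle_mean2 f r)"

text \<open>Operators on the Hardy space are represented by functions whose values outside
  \<^const>\<open>hardy2\<close> are irrelevant. Linearity is over the complex numbers, whereas the library's
  \<^const>\<open>bounded_linear\<close> is real linearity.\<close>

definition hardy2_bounded_operator ::
    "((complex \<Rightarrow> complex) \<Rightarrow> (complex \<Rightarrow> complex)) \<Rightarrow> bool" where
  "hardy2_bounded_operator X \<longleftrightarrow>
     X ` hardy2 \<subseteq> hardy2 \<and>
     (\<forall>f\<in>hardy2. \<forall>g\<in>hardy2. X (\<lambda>z. f z + g z) = (\<lambda>z. X f z + X g z)) \<and>
     (\<forall>c. \<forall>f\<in>hardy2. X (\<lambda>z. c * f z) = (\<lambda>z. c * X f z)) \<and>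
     (\<exists>K. \<forall>f\<in>hardy2. hardy2_norm (X f) \<le> K * hardy2_norm f)"

definition toeplitz ::
    "(complex \<Rightarrow> complex) \<Rightarrow> (complex \<Rightarrow> complex) \<Rightarrow> (complex \<Rightarrow> complex)" where
  "toeplitz \<phi> h = (\<lambda>z. \<phi> z * h z)"

definition intertwined ::
    "((complex \<Rightarrow> complex) \<Rightarrow> (complex \<Rightarrow> complex)) \<Rightarrow>
     ((complex \<Rightarrow> complex) \<Rightarrow> (complex \<Rightarrow> complex)) \<Rightarrow> bool"  (infix "\<propto>" 50) where
  "A \<propto> B \<longleftrightarrow>
     (\<exists>X. hardy2_bounded_operator X \<and> (\<exists>f\<in>hardy2. X f \<noteq> (\<lambda>z. 0)) \<and>
          (\<forall>f\<in>hardy2. X (A f) = B (X f)))"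

definition nondegenerate_continuum :: "complex set \<Rightarrow> bool" where
  "nondegenerate_continuum K \<longleftrightarrow> compact K \<and> connected K \<and> (\<exists>x\<in>K. \<exists>y\<in>K. x \<noteq> y)"

definition consists_of_nondegenerate_continua :: "complex set \<Rightarrow> bool" where
  "consists_of_nondegenerate_continua S \<longleftrightarrow>
     (\<exists>\<C>. (\<forall>K\<in>\<C>. nondegenerate_continuum K) \<and> S = \<Union>\<C>)"

end

theory Submission
  imports Defs
begin

text \<open>Suppose that some \<open>c = \<psi> a\<close> with \<open>a\<close> in the disc is not a value of \<open>\<phi>\<close>, and let \<open>X\<close>
  intertwine the two Toeplitz operators. The functional \<open>h \<mapsto> (X h) a\<close> is bounded and kills every
  multiple \<open>(\<phi> - c) g\<close>, since \<open>X ((\<phi> - c) g) = (\<psi> - c) X g\<close> vanishes at \<open>a\<close>. If those multiples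
  are dense, then \<open>(X h) a = 0\<close> for all \<open>h\<close>. The points \<open>a\<close> with \<open>\<psi> a\<close> outside the range of \<open>\<phi>\<close>
  accumulate in the disc as soon as there is one of them: the complement of that range has no
  isolated points, its boundary being made of nondegenerate continua, and a nonconstant \<open>\<psi>\<close> is
  open, while for a constant \<open>\<psi>\<close> every point of the disc is such a point. So \<open>X h\<close> vanishes identically, for every \<open>h\<close>, by the identity theorem.

  Everything therefore rests on the density of the multiples of \<open>F = \<phi> - c\<close>, that is, on \<open>F\<close> being
  outer. Density in the weak sense suffices: it is enough to have bounded analytic \<open>f\<^sub>n\<close> for which
  the products \<open>F f\<^sub>n\<close> are uniformly bounded and tend to 1 locally uniformly. This is
  \<open>approximately_invertible\<close>, and \<open>functional_zero_if_zero_on_multiples\<close> draws the conclusion, using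
  Parseval's identity to treat the Hardy space as a space of square summable sequences.

  If \<open>c\<close> is outside the closure of the range, \<open>1 / F\<close> itself is bounded. Otherwise \<open>c\<close> lies on a
  boundary continuum \<open>K\<close>, and connectedness of \<open>K\<close> provides points \<open>e\<close> of \<open>K - c\<close> on every
  sufficiently small circle around 0. None of these is a value of \<open>F\<close>. For small \<open>x\<close> choose \<open>n\<close> of
  them with moduli equally spaced in \<open>[x, 2 x]\<close>, and let \<open>Q\<close> be the geometric mean of the functions
  \<open>F - e\<close>; it is analytic because they have no zeros. Where \<open>\<bar>F\<bar>\<close> is much larger than \<open>x\<close>, the
  modulus of \<open>Q\<close> is close to that of \<open>F\<close>. Everywhere it is at least a constant multiple of \<open>x\<close>
  as \<open>n \<rightarrow> \<infinity>\<close>: a single factor may be very small, but its exponent is \<open>1 / n\<close>, and the mean of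
  \<open>log \<bar>y - s\<bar>\<close> over \<open>s\<close> in an interval is bounded below in \<open>y\<close>. So \<open>1 / Q\<close> is bounded and \<open>F / Q\<close>
  is bounded independently of \<open>x\<close> (\<open>holomorphic_of_size_near_circle\<close>, with \<open>f\<close> for the limit of \<open>1 / Q\<close>).
  As \<open>x \<rightarrow> 0\<close> the modulus of \<open>F f\<close> tends to 1, so by Montel's theorem and the maximum principle
  suitable unimodular multiples of \<open>F f\<close> tend to 1 along a subsequence (\<open>approximately_invertible_if_circles_met\<close>).\<close>

section \<open>Parseval's identity on circles\<close>

lemma has_integral_cis_int:
  fixes k :: int
  assumes "k \<noteq> 0"
  shows "((\<lambda>t. cis (of_int k * t)) has_integral 0) {0..2*pi}"
proof -
  define G where "G = (\<lambda>t::real. - \<i> * cis (of_int k * t) / of_int k)"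
  have "(G has_vector_derivative cis (of_int k * t)) (at t within {0..2*pi})" for t
  proof -
    have "((\<lambda>z. - \<i> * exp (\<i> * of_int k * z) / of_int k) has_field_derivative exp (\<i> * of_int k * of_real t))
        (at (of_real t))"
      using assms by (auto intro!: derivative_eq_intros simp: field_simps)
    from has_vector_derivative_real_field[OF this] show ?thesis
      by (simp add: G_def cis_conv_exp mult_ac)
  qed
  then have "((\<lambda>t. cis (of_int k * t)) has_integral (G (2*pi) - G 0)) {0..2*pi}"
    by (intro fundamental_theorem_of_calculus) auto
  moreover have "cis (of_int k * (2*pi)) = 1"
    using cis_multiple_2pi[of "of_int k"] by (simp add: mult_ac)
  ultimately show ?thesis by (simp add: G_def)
qed

lemma has_integral_norm_trig_polynomial:
  fixes b :: "nat \<Rightarrow> complex"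
  shows "((\<lambda>t. (cmod (\<Sum>n<N. b n * cis (real n * t)))\<^sup>2) has_integral
           2*pi * (\<Sum>n<N. (cmod (b n))\<^sup>2)) {0..2*pi}"
proof -
  have *: "((\<lambda>t. b m * cnj (b n) * cis (of_int (int m - int n) * t)) has_integral
          (if m = n then complex_of_real (2*pi * (cmod (b m))\<^sup>2) else 0)) {0..2*pi}" for m n
  proof (cases "m = n")
    case True
    have "((\<lambda>t::real. b m * cnj (b n)) has_integral (2*pi - 0) *\<^sub>R (b m * cnj (b n))) {0..2*pi}"
      using has_integral_const_real[of "b m * cnj (b n)" 0 "2*pi"] by simp
    moreover have "b m * cnj (b m) = of_real ((cmod (b m))\<^sup>2)"
      by (simp only: complex_norm_square)
    ultimately show ?thesis using True
      by (simp add: scaleR_conv_of_real)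
  next
    case False
    then show ?thesis using has_integral_mult_right[OF has_integral_cis_int[of "int m - int n"], of "b m * cnj (b n)"]
      by simp
  qed
  have "((\<lambda>t. \<Sum>m<N. \<Sum>n<N. b m * cnj (b n) * cis (of_int (int m - int n) * t)) has_integral
        (\<Sum>m<N. \<Sum>n<N. (if m = n then complex_of_real (2*pi * (cmod (b m))\<^sup>2) else 0))) {0..2*pi}"
    by (intro has_integral_sum * finite_lessThan)
  moreover have "(\<Sum>m<N. \<Sum>n<N. b m * cnj (b n) * cis (of_int (int m - int n) * t)) =
     of_real ((cmod (\<Sum>n<N. b n * cis (real n * t)))\<^sup>2)" for t
  proof -
    have "of_real ((cmod (\<Sum>n<N. b n * cis (real n * t)))\<^sup>2) =
        (\<Sum>n<N. b n * cis (real n * t)) * (\<Sum>n<N. cnj (b n) * cis (- (real n * t)))"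
      by (simp only: complex_norm_square cnj_sum complex_cnj_mult cis_cnj)
    moreover have "cis (of_int (int m - int n) * t) = cis (real m * t) * cis (- (real n * t))" for m n
      by (simp add: cis_mult algebra_simps)
    ultimately show ?thesis
      by (simp only: sum_product mult_ac)
  qed
  moreover have "(\<Sum>m<N. \<Sum>n<N. (if m = n then complex_of_real (2*pi * (cmod (b m))\<^sup>2) else 0)) =
     complex_of_real (2*pi * (\<Sum>n<N. (cmod (b n))\<^sup>2))"
    by (simp add: sum_distrib_left sum.delta)
  ultimately have "((\<lambda>t. complex_of_real ((cmod (\<Sum>n<N. b n * cis (real n * t)))\<^sup>2)) has_integral
           complex_of_real (2*pi * (\<Sum>n<N. (cmod (b n))\<^sup>2))) {0..2*pi}"
    by simp
  from has_integral_linear[OF this bounded_linear_Re] show ?thesis by (simp add: o_def)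
qed

text \<open>Parseval's identity on the circle of radius \<open>r\<close>: the series converges uniformly there, so the
  finite identity passes to the limit.\<close>

lemma circle_mean2_sums:
  assumes f: "\<And>z. cmod z < 1 \<Longrightarrow> (\<lambda>n. a n * z ^ n) sums f z" and r: "0 \<le> r" "r < 1"
  shows "(\<lambda>n. (cmod (a n))\<^sup>2 * r ^ (2*n)) sums circle_mean2 f r"
proof -
  define p where "p = (\<lambda>N t. \<Sum>n<N. (a n * of_real r ^ n) * cis (real n * t))"
  have p: "p N t = (\<Sum>n<N. a n * (of_real r * cis t) ^ n)" for N t
    by (simp add: p_def power_mult_distrib Complex.DeMoivre mult.assoc)
  obtain s where s: "r < s" "s < 1" using dense r(2) by blast
  have "summable (\<lambda>n. a n * of_real s ^ n)"
    using f[of "of_real s"] r s by (simp add: sums_iff)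
  then have "conv_radius a \<ge> ereal (norm (of_real s :: complex))"
    by (rule conv_radius_geI)
  moreover have "ereal r < ereal (norm (of_real s :: complex))" using r s by simp
  ultimately have cr: "ereal r < conv_radius a" by order
  have "uniform_limit (cball 0 r) (\<lambda>n x. \<Sum>i<n. a i * (x - 0) ^ i)
       (\<lambda>x. suminf (\<lambda>i. a i * (x - 0) ^ i)) sequentially"
    by (rule powser_uniform_limit[OF cr])
  then have "uniform_limit (cball 0 r) (\<lambda>n x. \<Sum>i<n. a i * x ^ i) f sequentially"
    by (rule uniform_limit_cong'[THEN iffD1, rotated -1]) (use f r in \<open>auto simp: sums_iff\<close>)
  then have "uniform_limit {0..2*pi} (\<lambda>N t. p N t) (\<lambda>t. f (of_real r * cis t)) sequentially"
    unfolding p by (rule uniform_limit_compose') (use r in \<open>auto simp: norm_mult\<close>)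
  then have u: "uniform_limit {0..2*pi} (\<lambda>N t. cmod (p N t)) (\<lambda>t. cmod (f (of_real r * cis t))) sequentially"
    by (rule uniform_limit_norm)
  moreover have "bounded ((\<lambda>t. cmod (f (of_real r * cis t))) ` {0..2*pi})"
  proof -
    have "f holomorphic_on ball 0 1"
      by (rule power_series_holomorphic[where a = a]) (use f in auto)
    then have "continuous_on (cball 0 r) f"
      using r by (auto intro!: holomorphic_on_imp_continuous_on elim: holomorphic_on_subset)
    then have "bounded (f ` cball 0 r)"
      by (intro compact_imp_bounded compact_continuous_image) auto
    then show ?thesis using r unfolding bounded_iff by (force simp: norm_mult)
  qed
  ultimately have "uniform_limit {0..2*pi} (\<lambda>N t. cmod (p N t) * cmod (p N t))
       (\<lambda>t. cmod (f (of_real r * cis t)) * cmod (f (of_real r * cis t))) sequentially"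
    by (intro uniform_lim_mult u)
  then have lim: "uniform_limit {0..2*pi} (\<lambda>N t. (cmod (p N t))\<^sup>2)
       (\<lambda>t. (cmod (f (of_real r * cis t)))\<^sup>2) sequentially"
    by (simp add: power2_eq_square)
  have int: "((\<lambda>t. (cmod (p N t))\<^sup>2) has_integral 2*pi * (\<Sum>n<N. (cmod (a n))\<^sup>2 * r ^ (2*n))) {0..2*pi}" for N
    using has_integral_norm_trig_polynomial[of "\<lambda>n. a n * of_real r ^ n" N] r
    by (simp add: p_def norm_mult norm_power power_mult_distrib mult.commute flip: power_mult)
  obtain I J where I: "\<And>n. ((\<lambda>t. (cmod (p n t))\<^sup>2) has_integral I n) {0..2*pi}"
    and J: "((\<lambda>t. (cmod (f (of_real r * cis t)))\<^sup>2) has_integral J) {0..2*pi}"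
    and IJ: "I \<longlonglongrightarrow> J"
    by (rule uniform_limit_integral[OF lim])
       (auto simp: p_def intro!: continuous_intros)
  have "I = (\<lambda>N. 2*pi * (\<Sum>n<N. (cmod (a n))\<^sup>2 * r ^ (2*n)))"
    using I int has_integral_unique by blast
  then have "(\<lambda>N. (2*pi * (\<Sum>n<N. (cmod (a n))\<^sup>2 * r ^ (2*n))) / (2*pi)) \<longlonglongrightarrow> J / (2*pi)"
    using IJ by (intro tendsto_divide) auto
  moreover have "circle_mean2 f r = J / (2*pi)"
    using J by (simp add: circle_mean2_def integral_unique)
  ultimately show ?thesis by (simp add: sums_def)
qed

section \<open>The Hardy space as a space of sequences\<close>

definition disc_series :: "(nat \<Rightarrow> complex) \<Rightarrow> complex \<Rightarrow> complex" where
  "disc_series a = (\<lambda>z. if cmod z < 1 then \<Sum>n. a n * z ^ n else 0)"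

definition square_summable :: "(nat \<Rightarrow> complex) \<Rightarrow> bool" where
  "square_summable a \<longleftrightarrow> summable (\<lambda>n. (cmod (a n))\<^sup>2)"

lemma norm_coeff_le:
  assumes "square_summable a"
  shows "cmod (a n) \<le> sqrt (\<Sum>n. (cmod (a n))\<^sup>2)"
proof -
  have "(\<Sum>k\<in>{n}. (cmod (a k))\<^sup>2) \<le> (\<Sum>n. (cmod (a n))\<^sup>2)"
    using assms unfolding square_summable_def by (intro sum_le_suminf) auto
  then show ?thesis by (simp add: real_le_rsqrt)
qed

lemma square_summable_summable_norm:
  assumes "square_summable a" "cmod z < 1"
  shows "summable (\<lambda>n. cmod (a n * z ^ n))"
proof (rule summable_comparison_test')
  show "summable (\<lambda>n. sqrt (\<Sum>n. (cmod (a n))\<^sup>2) * cmod z ^ n)"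
    using assms(2) by (intro summable_mult summable_geometric) auto
  show "norm (cmod (a n * z ^ n)) \<le> sqrt (\<Sum>n. (cmod (a n))\<^sup>2) * cmod z ^ n" for n
    using norm_coeff_le[OF assms(1)] by (simp add: norm_mult norm_power mult_right_mono)
qed

lemma disc_series_sums:
  assumes "square_summable a" "cmod z < 1"
  shows "(\<lambda>n. a n * z ^ n) sums disc_series a z"
  using summable_norm_cancel[OF square_summable_summable_norm[OF assms]] assms(2)
  by (simp add: disc_series_def summable_sums)

text \<open>Every coefficient is at most the norm, so point evaluations are bounded by a geometric series.\<close>

lemma norm_disc_series_le:
  assumes a: "square_summable a" and z: "cmod z < 1"
  shows "cmod (disc_series a z) \<le> sqrt (\<Sum>n. (cmod (a n))\<^sup>2) / (1 - cmod z)"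
proof -
  have "cmod (disc_series a z) \<le> (\<Sum>n. cmod (a n * z ^ n))"
    using z summable_norm[OF square_summable_summable_norm[OF assms]] by (simp add: disc_series_def)
  also have "\<dots> \<le> (\<Sum>n. sqrt (\<Sum>n. (cmod (a n))\<^sup>2) * cmod z ^ n)"
    using norm_coeff_le[OF a] z
    by (intro suminf_le square_summable_summable_norm assms summable_mult summable_geometric)
       (auto simp: norm_mult norm_power mult_right_mono)
  also have "\<dots> = sqrt (\<Sum>n. (cmod (a n))\<^sup>2) / (1 - cmod z)"
    using z by (simp add: suminf_mult suminf_geometric)
  finally show ?thesis .
qed

text \<open>A finite section of the Parseval sum at radius \<open>r\<close> is continuous in \<open>r\<close>, which allows \<open>r \<rightarrow> 1\<close>.\<close>

lemma coeff_sum_le_Sup_circle_mean2: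
  assumes f: "\<And>z. cmod z < 1 \<Longrightarrow> (\<lambda>n. a n * z ^ n) sums f z"
    and bdd: "bdd_above (circle_mean2 f ` {0..<1})"
  shows "(\<Sum>n<N. (cmod (a n))\<^sup>2) \<le> (SUP r\<in>{0..<1}. circle_mean2 f r)" (is "_ \<le> ?T")
proof -
  have "(\<Sum>n<N. (cmod (a n))\<^sup>2 * r ^ (2*n)) \<le> ?T" if r: "0 \<le> r" "r < 1" for r
  proof -
    have s: "(\<lambda>n. (cmod (a n))\<^sup>2 * r ^ (2*n)) sums circle_mean2 f r"
      by (rule circle_mean2_sums[OF f r])
    have "(\<Sum>n<N. (cmod (a n))\<^sup>2 * r ^ (2*n)) \<le> circle_mean2 f r"
      using sum_le_suminf[OF sums_summable[OF s], of "{..<N}"] sums_unique[OF s] r by simp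
    also have "\<dots> \<le> ?T" using r by (intro cSUP_upper bdd) auto
    finally show ?thesis .
  qed
  then have "eventually (\<lambda>r. (\<Sum>n<N. (cmod (a n))\<^sup>2 * r ^ (2*n)) \<le> ?T) (at_left (1::real))"
    using eventually_at_left_real[of 0 "1::real"] by (auto elim!: eventually_mono)
  moreover have "((\<lambda>r. \<Sum>n<N. (cmod (a n))\<^sup>2 * r ^ (2*n)) \<longlongrightarrow> (\<Sum>n<N. (cmod (a n))\<^sup>2 * 1 ^ (2*n)))
      (at_left (1::real))"
    by (intro tendsto_intros)
  ultimately show ?thesis
    using tendsto_upperbound by fastforce
qed

text \<open>Together with \<open>hardy2_eq_disc_series\<close> this identifies the Hardy space, isometrically, with the
  square summable sequences.\<close>

lemma disc_series_hardy2:
  assumes a: "square_summable a"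
  shows "disc_series a \<in> hardy2"
    and "hardy2_norm (disc_series a) = sqrt (\<Sum>n. (cmod (a n))\<^sup>2)"
proof -
  define S where "S = (\<Sum>n. (cmod (a n))\<^sup>2)"
  have sa: "summable (\<lambda>n. (cmod (a n))\<^sup>2)" using a by (simp add: square_summable_def)
  have holo: "disc_series a holomorphic_on ball 0 1"
    by (rule power_series_holomorphic[where a = a]) (auto intro: disc_series_sums[OF a])
  have M: "(\<lambda>n. (cmod (a n))\<^sup>2 * r ^ (2*n)) sums circle_mean2 (disc_series a) r" if "0 \<le> r" "r < 1" for r
    by (rule circle_mean2_sums) (use disc_series_sums[OF a] that in auto)
  have upper: "circle_mean2 (disc_series a) r \<le> S" if "r \<in> {0..<1}" for r
    unfolding S_def using that
    by (intro sums_le[OF _ M summable_sums[OF sa]]) (auto intro!: mult_left_le power_le_one)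
  then have bdd: "bdd_above (circle_mean2 (disc_series a) ` {0..<1})"
    by (intro bdd_aboveI2[where M = S]) auto
  show "disc_series a \<in> hardy2"
    using holo bdd by (auto simp: hardy2_def disc_series_def)
  have "(SUP r\<in>{0..<1}. circle_mean2 (disc_series a) r) \<le> S"
    using upper by (intro cSUP_least) auto
  moreover have "S \<le> (SUP r\<in>{0..<1}. circle_mean2 (disc_series a) r)"
    unfolding S_def
    by (rule suminf_le_const[OF sa coeff_sum_le_Sup_circle_mean2[OF disc_series_sums[OF a] bdd]])
  ultimately show "hardy2_norm (disc_series a) = sqrt (\<Sum>n. (cmod (a n))\<^sup>2)"
    by (simp add: hardy2_norm_def S_def)
qed

definition taylor_coeff :: "(complex \<Rightarrow> complex) \<Rightarrow> nat \<Rightarrow> complex" where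
  "taylor_coeff f n = (deriv ^^ n) f 0 / fact n"

lemma hardy2_eq_disc_series:
  assumes f: "f \<in> hardy2"
  shows "square_summable (taylor_coeff f)" and "f = disc_series (taylor_coeff f)"
proof -
  have sums: "(\<lambda>n. taylor_coeff f n * z ^ n) sums f z" if "cmod z < 1" for z
    using holomorphic_power_series[of f 0 1 z] f that by (simp add: hardy2_def taylor_coeff_def)
  have "bdd_above (circle_mean2 f ` {0..<1})" using f by (simp add: hardy2_def)
  note coeff_sum_le_Sup_circle_mean2[OF sums this]
  then show "square_summable (taylor_coeff f)"
    unfolding square_summable_def by (intro summableI_nonneg_bounded) auto
  show "f = disc_series (taylor_coeff f)"
    using f sums by (auto simp: disc_series_def hardy2_def sums_iff fun_eq_iff)
qed

section \<open>Bounded functionals and weak limits\<close>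

definition hardy2_functional :: "((complex \<Rightarrow> complex) \<Rightarrow> complex) \<Rightarrow> bool" where
  "hardy2_functional L \<longleftrightarrow>
     (\<forall>f\<in>hardy2. \<forall>g\<in>hardy2. L (\<lambda>z. f z + g z) = L f + L g) \<and>
     (\<forall>c. \<forall>f\<in>hardy2. L (\<lambda>z. c * f z) = c * L f) \<and>
     (\<exists>K. \<forall>f\<in>hardy2. cmod (L f) \<le> K * hardy2_norm f)"

definition monomial :: "nat \<Rightarrow> complex \<Rightarrow> complex" where
  "monomial n = disc_series (\<lambda>k. if k = n then 1 else 0)"

lemma square_summable_mono:
  assumes "square_summable a" "\<And>n. cmod (b n) \<le> cmod (a n)"
  shows "square_summable b"
  unfolding square_summable_def
  by (rule summable_comparison_test'[OF assms(1)[unfolded square_summable_def], of 0])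
     (use assms(2) in \<open>auto intro: power_mono\<close>)

lemma square_summable_finite:
  assumes "\<And>n. n \<ge> N \<Longrightarrow> a n = 0"
  shows "square_summable a"
  unfolding square_summable_def
  by (rule summable_finite[of "{..<N}"]) (use assms in \<open>auto simp: not_less\<close>)

lemma disc_series_add:
  assumes "square_summable a" "square_summable b"
  shows "disc_series (\<lambda>n. a n + b n) = (\<lambda>z. disc_series a z + disc_series b z)"
proof
  fix z show "disc_series (\<lambda>n. a n + b n) z = disc_series a z + disc_series b z"
  proof (cases "cmod z < 1")
    case True
    have "(\<lambda>n. (a n + b n) * z ^ n) sums (disc_series a z + disc_series b z)"
      using sums_add[OF disc_series_sums[OF assms(1) True] disc_series_sums[OF assms(2) True]]
      by (simp add: distrib_right)
    then show ?thesis using True by (simp add: disc_series_def sums_iff)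
  qed (simp add: disc_series_def)
qed

lemma disc_series_scale:
  assumes "square_summable a"
  shows "disc_series (\<lambda>n. c * a n) = (\<lambda>z. c * disc_series a z)"
proof
  fix z show "disc_series (\<lambda>n. c * a n) z = c * disc_series a z"
  proof (cases "cmod z < 1")
    case True
    have "(\<lambda>n. (c * a n) * z ^ n) sums (c * disc_series a z)"
      using sums_mult[OF disc_series_sums[OF assms(1) True]]
      by (simp add: mult.assoc)
    then show ?thesis using True by (simp add: disc_series_def sums_iff)
  qed (simp add: disc_series_def)
qed

lemma functional_disc_series_polynomial:
  assumes L: "hardy2_functional L"
  shows "L (disc_series (\<lambda>n. if n < N then a n else 0)) = (\<Sum>n<N. a n * L (monomial n))"
proof (induction N)
  case 0
  have "square_summable (\<lambda>n. 0)" by (simp add: square_summable_def)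
  then have "L (\<lambda>z. 0 * disc_series (\<lambda>n. 0) z) = 0 * L (disc_series (\<lambda>n. 0))"
    using L disc_series_hardy2 unfolding hardy2_functional_def by blast
  moreover have "disc_series (\<lambda>n. 0) = (\<lambda>z. 0)" by (simp add: disc_series_def fun_eq_iff)
  ultimately show ?case by simp
next
  case (Suc N)
  let ?t = "\<lambda>N n. if n < N then a n else 0" and ?d = "\<lambda>k. if k = N then 1 else 0 :: complex"
  have t: "square_summable (?t N)" by (rule square_summable_finite[of N]) auto
  have d: "square_summable ?d" by (rule square_summable_finite[of "Suc N"]) auto
  have ad: "square_summable (\<lambda>n. a N * ?d n)" by (rule square_summable_finite[of "Suc N"]) auto
  have "?t (Suc N) = (\<lambda>n. ?t N n + a N * ?d n)" by (auto simp: fun_eq_iff less_Suc_eq)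
  then have "disc_series (?t (Suc N)) = (\<lambda>z. disc_series (?t N) z + disc_series (\<lambda>n. a N * ?d n) z)"
    using disc_series_add[OF t ad] by simp
  then have "L (disc_series (?t (Suc N))) = L (disc_series (?t N)) + L (disc_series (\<lambda>n. a N * ?d n))"
    using L disc_series_hardy2[OF t] disc_series_hardy2[OF ad] unfolding hardy2_functional_def by simp
  also have "L (disc_series (\<lambda>n. a N * ?d n)) = a N * L (monomial N)"
    using L disc_series_hardy2[OF d] unfolding disc_series_scale[OF d] monomial_def hardy2_functional_def by blast
  finally show ?case using Suc by simp
qed

text \<open>The remainders of the power series tend to 0 in norm, so a bounded functional may be applied term
  by term.\<close>

lemma functional_disc_series_sums:
  assumes L: "hardy2_functional L" and a: "square_summable a"
  shows "(\<lambda>n. a n * L (monomial n)) sums L (disc_series a)"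
proof -
  obtain K where K: "\<And>f. f \<in> hardy2 \<Longrightarrow> cmod (L f) \<le> K * hardy2_norm f"
    using L unfolding hardy2_functional_def by blast
  have sa: "summable (\<lambda>n. (cmod (a n))\<^sup>2)" using a by (simp add: square_summable_def)
  have err: "cmod (L (disc_series a) - (\<Sum>n<N. a n * L (monomial n))) \<le>
      K * sqrt (\<Sum>n. (cmod (a (n + N)))\<^sup>2)" for N
  proof -
    let ?t = "\<lambda>n. if n < N then a n else 0" and ?r = "\<lambda>n. if n < N then 0 else a n"
    have t: "square_summable ?t" and r: "square_summable ?r"
      by (auto intro: square_summable_mono[OF a])
    have "a = (\<lambda>n. ?t n + ?r n)" by auto
    then have "disc_series a = (\<lambda>z. disc_series ?t z + disc_series ?r z)"
      using disc_series_add[OF t r] by simp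
    then have "L (disc_series a) = L (disc_series ?t) + L (disc_series ?r)"
      using L disc_series_hardy2[OF t] disc_series_hardy2[OF r] unfolding hardy2_functional_def by simp
    then have "L (disc_series a) - (\<Sum>n<N. a n * L (monomial n)) = L (disc_series ?r)"
      using functional_disc_series_polynomial[OF L, of N a] by simp
    moreover have "(\<Sum>n. (cmod (?r n))\<^sup>2) = (\<Sum>n. (cmod (a (n + N)))\<^sup>2)"
      using r suminf_split_initial_segment[of "\<lambda>n. (cmod (?r n))\<^sup>2" N] by (simp add: square_summable_def)
    ultimately show ?thesis
      using K[OF disc_series_hardy2(1)[OF r]] disc_series_hardy2(2)[OF r] by simp
  qed
  have "(\<lambda>N. \<Sum>n. (cmod (a (n + N)))\<^sup>2) \<longlonglongrightarrow> 0"
    by (rule suminf_exist_split2[OF sa])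
  then have "(\<lambda>N. K * sqrt (\<Sum>n. (cmod (a (n + N)))\<^sup>2)) \<longlonglongrightarrow> K * sqrt 0"
    by (intro tendsto_intros)
  then have "(\<lambda>N. K * sqrt (\<Sum>n. (cmod (a (n + N)))\<^sup>2)) \<longlonglongrightarrow> 0" by simp
  then have "(\<lambda>N. L (disc_series a) - (\<Sum>n<N. a n * L (monomial n))) \<longlonglongrightarrow> 0"
    by (rule Lim_null_comparison[OF always_eventually, rotated]) (intro allI err)
  from tendsto_diff[OF tendsto_const[of "L (disc_series a)"] this]
  show ?thesis by (simp add: sums_def)
qed

text \<open>This is the Riesz representation of \<open>L\<close> in coordinates, obtained by testing \<open>L\<close> on the polynomial
  whose coefficients are the conjugates of its own values.\<close>

lemma functional_monomials_square_summable:
  assumes L: "hardy2_functional L"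
  shows "square_summable (\<lambda>n. L (monomial n))"
proof -
  obtain K where K: "\<And>f. f \<in> hardy2 \<Longrightarrow> cmod (L f) \<le> K * hardy2_norm f"
    using L unfolding hardy2_functional_def by blast
  have "(\<Sum>n<N. (cmod (L (monomial n)))\<^sup>2) \<le> K\<^sup>2" for N
  proof -
    define S where "S = (\<Sum>n<N. (cmod (L (monomial n)))\<^sup>2)"
    let ?a = "\<lambda>n. if n < N then cnj (L (monomial n)) else 0"
    have a: "square_summable ?a" by (rule square_summable_finite[of N]) auto
    have "L (disc_series ?a) = of_real S"
      unfolding S_def functional_disc_series_polynomial[OF L] of_real_sum
      by (simp only: complex_norm_square mult.commute)
    moreover have "(\<Sum>n. (cmod (?a n))\<^sup>2) = S"
      unfolding S_def by (subst suminf_finite[of "{..<N}"]) auto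
    moreover have "S \<ge> 0" by (simp add: S_def sum_nonneg)
    ultimately have "sqrt S * sqrt S \<le> K * sqrt S"
      using K[OF disc_series_hardy2(1)[OF a]] disc_series_hardy2(2)[OF a] by simp
    then have "sqrt S \<le> K \<or> sqrt S = 0"
      using \<open>S \<ge> 0\<close> mult_right_le_imp_le[of "sqrt S" "sqrt S" K] by (cases "S = 0") auto
    then show ?thesis
      using \<open>S \<ge> 0\<close> by (auto simp: S_def[symmetric] intro: sqrt_le_D)
  qed
  then show ?thesis
    unfolding square_summable_def by (intro summableI_nonneg_bounded) auto
qed

text \<open>By Cauchy--Schwarz the error is the norm of \<open>a\<close> times a factor that depends on \<open>N\<close> and \<open>L\<close> only;
  this uniformity gives weak convergence below.\<close>

lemma functional_truncation_error:
  assumes L: "hardy2_functional L" and a: "square_summable a"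
  shows "cmod (L (disc_series a) - (\<Sum>n<N. a n * L (monomial n))) \<le>
    sqrt (\<Sum>n. (cmod (a n))\<^sup>2) * sqrt (\<Sum>n. (cmod (L (monomial (n + N))))\<^sup>2)"
proof -
  let ?l = "\<lambda>n. L (monomial n)"
  have sa: "summable (\<lambda>n. (cmod (a n))\<^sup>2)" using a by (simp add: square_summable_def)
  have sl: "summable (\<lambda>n. (cmod (?l n))\<^sup>2)"
    using functional_monomials_square_summable[OF L] by (simp add: square_summable_def)
  have lim: "(\<lambda>M. cmod (\<Sum>n<M. a (n + N) * ?l (n + N))) \<longlonglongrightarrow> cmod (L (disc_series a) - (\<Sum>n<N. a n * ?l n))"
    using sums_split_initial_segment[OF functional_disc_series_sums[OF L a], of N]
    by (intro tendsto_norm) (simp add: sums_def)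
  show ?thesis
  proof (rule LIMSEQ_le_const2[OF lim], intro exI allI impI)
    fix M :: nat
    have "cmod (\<Sum>n<M. a (n + N) * ?l (n + N)) \<le> (\<Sum>n<M. \<bar>cmod (a (n + N))\<bar> * \<bar>cmod (?l (n + N))\<bar>)"
      by (rule order_trans[OF norm_sum]) (simp add: norm_mult)
    also have "\<dots> \<le> L2_set (\<lambda>n. cmod (a (n + N))) {..<M} * L2_set (\<lambda>n. cmod (?l (n + N))) {..<M}"
      by (rule L2_set_mult_ineq)
    also have "\<dots> \<le> sqrt (\<Sum>n. (cmod (a n))\<^sup>2) * sqrt (\<Sum>n. (cmod (?l (n + N)))\<^sup>2)"
      unfolding L2_set_def
    proof (intro mult_mono real_sqrt_le_mono)
      have "(\<Sum>n<M. (cmod (a (n + N)))\<^sup>2) = (\<Sum>n\<in>{N..<N+M}. (cmod (a n))\<^sup>2)"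
        by (rule sum.reindex_bij_witness[of _ "\<lambda>n. n - N" "\<lambda>n. n + N"]) auto
      also have "\<dots> \<le> (\<Sum>n. (cmod (a n))\<^sup>2)"
        by (intro sum_le_suminf sa) auto
      finally show "(\<Sum>n<M. (cmod (a (n + N)))\<^sup>2) \<le> (\<Sum>n. (cmod (a n))\<^sup>2)" .
      show "(\<Sum>n<M. (cmod (?l (n + N)))\<^sup>2) \<le> (\<Sum>n. (cmod (?l (n + N)))\<^sup>2)"
        by (intro sum_le_suminf summable_ignore_initial_segment[OF sl]) auto
    qed (auto intro!: suminf_nonneg sa sum_nonneg)
    finally show "cmod (\<Sum>n<M. a (n + N) * ?l (n + N)) \<le>
      sqrt (\<Sum>n. (cmod (a n))\<^sup>2) * sqrt (\<Sum>n. (cmod (?l (n + N)))\<^sup>2)" .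
  qed
qed

text \<open>In a norm-bounded family, convergence of each coefficient is weak convergence.\<close>

lemma functional_weak_limit:
  assumes L: "hardy2_functional L"
    and v: "\<And>j. square_summable (v j)" "\<And>j. (\<Sum>n. (cmod (v j n))\<^sup>2) \<le> B"
    and lim: "\<And>n. (\<lambda>j. v j n) \<longlonglongrightarrow> a n" and a: "square_summable a"
  shows "(\<lambda>j. L (disc_series (v j))) \<longlonglongrightarrow> L (disc_series a)"
proof (rule LIMSEQ_I)
  fix e :: real assume e: "e > 0"
  let ?l = "\<lambda>n. L (monomial n)"
  define R where "R = (\<lambda>N. sqrt (\<Sum>n. (cmod (?l (n + N)))\<^sup>2))"
  define C where "C = sqrt B + sqrt (\<Sum>n. (cmod (a n))\<^sup>2)"
  have "(\<lambda>N. \<Sum>n. (cmod (?l (n + N)))\<^sup>2) \<longlonglongrightarrow> 0"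
    using functional_monomials_square_summable[OF L] by (intro suminf_exist_split2) (simp add: square_summable_def)
  then have "R \<longlonglongrightarrow> sqrt 0"
    unfolding R_def by (rule tendsto_real_sqrt)
  then have "(\<lambda>N. C * R N) \<longlonglongrightarrow> C * sqrt 0"
    by (rule tendsto_mult_left)
  note order_tendstoD(2)[OF this, of "e / 2"]
  then have "eventually (\<lambda>N. C * R N < e / 2) sequentially"
    using e by simp
  then obtain N where N: "C * R N < e / 2" by (auto simp: eventually_sequentially)
  have vlim: "(\<lambda>j. (\<Sum>n<N. v j n * ?l n)) \<longlonglongrightarrow> (\<Sum>n<N. a n * ?l n)"
    by (intro tendsto_intros lim)
  then obtain J where J: "\<And>j. j \<ge> J \<Longrightarrow> cmod ((\<Sum>n<N. v j n * ?l n) - (\<Sum>n<N. a n * ?l n)) < e / 2"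
    using LIMSEQ_D[OF vlim, of "e/2"] e by auto
  have "summable (\<lambda>n. (cmod (?l (n + N)))\<^sup>2)"
    using functional_monomials_square_summable[OF L] unfolding square_summable_def
    by (rule summable_ignore_initial_segment)
  then have R0: "R N \<ge> 0" unfolding R_def by (simp add: suminf_nonneg)
  have "cmod (L (disc_series (v j)) - L (disc_series a)) < e" if "j \<ge> J" for j
  proof -
    have "cmod (L (disc_series (v j)) - (\<Sum>n<N. v j n * ?l n)) \<le> sqrt B * R N"
    proof (rule order_trans)
      show "cmod (L (disc_series (v j)) - (\<Sum>n<N. v j n * ?l n)) \<le> sqrt (\<Sum>n. (cmod (v j n))\<^sup>2) * R N"
        unfolding R_def by (rule functional_truncation_error[OF L v(1)])
      show "sqrt (\<Sum>n. (cmod (v j n))\<^sup>2) * R N \<le> sqrt B * R N"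
        by (intro mult_right_mono real_sqrt_le_mono v R0)
    qed
    moreover have "cmod (L (disc_series a) - (\<Sum>n<N. a n * ?l n)) \<le> sqrt (\<Sum>n. (cmod (a n))\<^sup>2) * R N"
      using functional_truncation_error[OF L a] by (simp add: R_def)
    moreover have "cmod x < e" if "x = (l - s) + (s - t) - (m - t)" "cmod (l - s) \<le> p" "cmod (s - t) < e / 2"
        "cmod (m - t) \<le> q" "p + q < e / 2" for x l s t m :: complex and p q
      unfolding that(1) using that(2-) norm_triangle_ineq4[of "(l - s) + (s - t)" "m - t"]
        norm_triangle_ineq[of "l - s" "s - t"] by linarith
    ultimately show ?thesis
      using J[OF that] N unfolding C_def distrib_right by simp
  qed
  then show "\<exists>J. \<forall>j\<ge>J. norm (L (disc_series (v j)) - L (disc_series a)) < e" by blast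
qed

section \<open>Products of distances to equally spaced points\<close>

text \<open>Compare \<open>exp n\<close> with one term of its series; a crude form of Stirling's lower bound.\<close>

lemma power_le_exp_mult_fact: "real n ^ n \<le> exp (real n) * fact n"
proof -
  have s: "(\<lambda>k. real n ^ k /\<^sub>R fact k) sums exp (real n)"
    by (rule exp_converges)
  have "(\<Sum>k\<in>{n}. real n ^ k /\<^sub>R fact k) \<le> exp (real n)"
    unfolding sums_unique[OF s] by (rule sum_le_suminf[OF sums_summable[OF s]]) auto
  then show ?thesis
    by (simp add: divide_inverse[symmetric] scaleR_conv_of_real field_simps)
qed

lemma prod_dist_to_index:
  assumes "j < n"
  shows "(\<Prod>i\<in>{..<n} - {j}. \<bar>real i - real j\<bar>) = fact j * fact (n - 1 - j)"
proof -
  have split: "{..<n} - {j} = {..<j} \<union> {Suc j..<n}" using assms by auto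
  have "(\<Prod>i\<in>{..<n} - {j}. \<bar>real i - real j\<bar>) =
      (\<Prod>i<j. \<bar>real i - real j\<bar>) * (\<Prod>i\<in>{Suc j..<n}. \<bar>real i - real j\<bar>)"
    unfolding split by (rule prod.union_disjoint) auto
  also have "(\<Prod>i<j. \<bar>real i - real j\<bar>) = (\<Prod>k\<in>{1..j}. real k)"
    by (rule prod.reindex_bij_witness[of _ "\<lambda>k. j - k" "\<lambda>i. j - i"]) (auto simp: of_nat_diff)
  also have "(\<Prod>i\<in>{Suc j..<n}. \<bar>real i - real j\<bar>) = (\<Prod>k\<in>{1..n - 1 - j}. real k)"
    by (rule prod.reindex_bij_witness[of _ "\<lambda>k. k + j" "\<lambda>i. i - j"]) (auto simp: of_nat_diff)
  finally show ?thesis by (simp add: fact_prod)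
qed

text \<open>For \<open>i \<noteq> j\<close> the distance from \<open>t\<close> to \<open>i\<close> is at least half the distance from \<open>j\<close> to \<open>i\<close>, because
  \<open>j\<close> is nearest to \<open>t\<close>. This reduces the claim to \<open>j! (n - 1 - j)! \<ge> (n - 1)! / 2\<^bsup>n - 1\<^esup>\<close>.\<close>

lemma prod_dist_nearest_index_ge:
  fixes t :: real
  assumes j: "j < n" and nearest: "\<And>i. i < n \<Longrightarrow> \<bar>t - real j\<bar> \<le> \<bar>t - real i\<bar>"
  shows "(real n / (4 * exp 1)) ^ n \<le> real n * (\<Prod>i\<in>{..<n} - {j}. \<bar>t - real i\<bar>)"
proof -
  obtain m where n: "n = Suc m" using j by (cases n) auto
  define Q where "Q = (\<Prod>i\<in>{..<n} - {j}. \<bar>t - real i\<bar>)"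
  have "Q \<ge> 0" unfolding Q_def by (intro prod_nonneg) auto
  have "fact m = fact j * fact (m - j) * (m choose j)"
    using j n by (subst binomial_fact_lemma) auto
  then have "(fact m :: real) = fact j * fact (m - j) * real (m choose j)"
    by (metis of_nat_fact of_nat_mult)
  also have "\<dots> \<le> fact j * fact (m - j) * 2 ^ m"
    using binomial_le_pow2[of m j] by (intro mult_left_mono) (auto simp flip: of_nat_power of_nat_le_iff)
  also have "fact j * fact (m - j) = (\<Prod>i\<in>{..<n} - {j}. \<bar>real i - real j\<bar>)"
    using prod_dist_to_index[OF j] n by simp
  also have "\<dots> \<le> (\<Prod>i\<in>{..<n} - {j}. 2 * \<bar>t - real i\<bar>)"
  proof (rule prod_mono)
    fix i assume "i \<in> {..<n} - {j}"
    then have "\<bar>t - real j\<bar> \<le> \<bar>t - real i\<bar>" using nearest by simp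
    then show "0 \<le> \<bar>real i - real j\<bar> \<and> \<bar>real i - real j\<bar> \<le> 2 * \<bar>t - real i\<bar>"
      using abs_triangle_ineq4[of "t - real j" "t - real i"] by auto
  qed
  also have "\<dots> = 2 ^ m * (\<Prod>i\<in>{..<n} - {j}. \<bar>t - real i\<bar>)"
    using j n by (simp add: prod.distrib)
  finally have "fact m \<le> 2 ^ m * Q * 2 ^ m"
    unfolding Q_def by simp
  moreover have "(2::real) ^ m * 2 ^ m = 4 ^ m" by (simp flip: power_mult_distrib)
  ultimately have "fact m \<le> 4 ^ m * Q" by (simp add: mult_ac)
  then have "real n * fact m \<le> real n * (4 ^ n * Q)"
    using n \<open>Q \<ge> 0\<close> by (intro mult_left_mono) (auto intro: order_trans)
  then have "fact n \<le> 4 ^ n * (real n * Q)" using n by (simp add: mult_ac)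
  then have "exp (real n) * fact n \<le> exp (real n) * (4 ^ n * (real n * Q))"
    by simp
  also have "\<dots> = (4 * exp 1) ^ n * (real n * Q)"
    using exp_of_nat_mult[of n "1::real"] by (simp add: power_mult_distrib)
  finally have "real n ^ n \<le> (real n * Q) * (4 * exp 1) ^ n"
    using power_le_exp_mult_fact[of n] by (simp add: mult.commute)
  then show ?thesis unfolding Q_def by (simp add: power_divide divide_le_eq)
qed

text \<open>The discrete form of the lower bound for the mean of \<open>log \<bar>y - s\<bar>\<close>. The number \<open>\<delta>\<close> accounts for
  the one point that may be arbitrarily close to \<open>w\<close>; it enters only to the first power, so its
  effect disappears after taking \<open>n\<close>-th roots.\<close>

lemma prod_dist_points_ge:
  fixes w :: complex and e :: "nat \<Rightarrow> complex"
  assumes x: "x > 0" and n: "n > 0" and \<delta>: "\<delta> > 0"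
    and e: "\<And>i. i < n \<Longrightarrow> cmod (e i) = x * (1 + real i / real n)"
    and far: "\<And>i. i < n \<Longrightarrow> \<delta> \<le> cmod (w - e i)"
  shows "\<delta> / x * (x / (4 * exp 1)) ^ n \<le> (\<Prod>i<n. cmod (w - e i))"
proof -
  define t where "t = real n * (cmod w / x - 1)"
  define j where "j = arg_min_on (\<lambda>i. \<bar>t - real i\<bar>) {..<n}"
  have ne: "{..<n} \<noteq> {}" using n by auto
  have j: "j < n" and nearest: "\<And>i. i < n \<Longrightarrow> \<bar>t - real j\<bar> \<le> \<bar>t - real i\<bar>"
    using arg_min_if_finite(1)[OF finite_lessThan ne, of "\<lambda>i. \<bar>t - real i\<bar>"]
      arg_min_least[OF finite_lessThan ne, of _ "\<lambda>i. \<bar>t - real i\<bar>"]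
    unfolding j_def by auto
  have dist: "x / real n * \<bar>t - real i\<bar> \<le> cmod (w - e i)" if "i < n" for i
  proof -
    have "x / real n * (t - real i) = cmod w - cmod (e i)"
      using x n e[OF that] by (simp add: t_def field_simps)
    then have "x / real n * \<bar>t - real i\<bar> = \<bar>cmod w - cmod (e i)\<bar>"
      using x by (metis abs_mult abs_of_nonneg divide_nonneg_nonneg less_eq_real_def of_nat_0_le_iff)
    then show ?thesis using norm_triangle_ineq3[of w "e i"] by simp
  qed
  have "\<delta> / x * (x / (4 * exp 1)) ^ n = \<delta> / x * ((x / real n) ^ n * (real n / (4 * exp 1)) ^ n)"
    using n by (simp flip: power_mult_distrib)
  also have "\<dots> \<le> \<delta> / x * ((x / real n) ^ n * (real n * (\<Prod>i\<in>{..<n} - {j}. \<bar>t - real i\<bar>)))"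
    using prod_dist_nearest_index_ge[OF j nearest] x n \<delta> by (intro mult_left_mono) auto
  also have "\<dots> = \<delta> * ((x / real n) ^ (n - 1) * (\<Prod>i\<in>{..<n} - {j}. \<bar>t - real i\<bar>))"
    using x n by (simp add: power_eq_if[of _ n] del: power_divide)
  also have "(x / real n) ^ (n - 1) * (\<Prod>i\<in>{..<n} - {j}. \<bar>t - real i\<bar>) =
      (\<Prod>i\<in>{..<n} - {j}. x / real n * \<bar>t - real i\<bar>)"
    using j by (simp only: prod.distrib prod_constant card_Diff_singleton finite_lessThan lessThan_iff card_lessThan)
  also have "\<delta> * \<dots> \<le> cmod (w - e j) * (\<Prod>i\<in>{..<n} - {j}. cmod (w - e i))"
    using x dist by (intro mult_mono far j prod_mono prod_nonneg) auto
  also have "\<dots> = (\<Prod>i<n. cmod (w - e i))"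
    using j by (simp add: prod.remove[of "{..<n}" j])
  finally show ?thesis .
qed

section \<open>Approximate inverses of functions that omit a continuum\<close>

text \<open>A branch of \<open>P\<^bsup>-1/n\<^esup>\<close>, described by its modulus, which is what the limits below are about.\<close>

lemma norm_holomorphic_root:
  assumes P: "P holomorphic_on ball 0 1" "\<And>z. z \<in> ball 0 1 \<Longrightarrow> P z \<noteq> 0" and n: "n > 0"
  obtains f where "f holomorphic_on ball 0 1"
    "\<And>z. z \<in> ball 0 1 \<Longrightarrow> cmod (f z) ^ n * cmod (P z) = 1"
proof -
  obtain g where g: "g holomorphic_on ball 0 1" "\<And>z. z \<in> ball 0 1 \<Longrightarrow> P z = exp (g z)"
    using contractible_imp_holomorphic_log[OF P(1) _ P(2)] convex_imp_contractible[OF convex_ball] by blast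
  show ?thesis
  proof
    show "(\<lambda>z. exp (- g z / of_nat n)) holomorphic_on ball 0 1"
      using n by (intro holomorphic_intros g) auto
    fix z :: complex assume z: "z \<in> ball 0 1"
    have "exp (- g z / of_nat n) ^ n = exp (- g z)"
      using n by (simp flip: exp_of_nat_mult)
    then have "cmod (exp (- g z / of_nat n)) ^ n = cmod (exp (- g z))"
      by (metis norm_power)
    then show "cmod (exp (- g z / of_nat n)) ^ n * cmod (P z) = 1"
      by (simp add: g(2)[OF z] flip: exp_add)
  qed
qed

text \<open>The function \<open>f\<close> is \<open>1 / Q\<close>, for \<open>Q\<close> a limit of geometric means of the functions \<open>F - e\<close> with
  \<open>e\<close> in \<open>E\<close> and \<open>\<bar>e\<bar>\<close> equidistributed in \<open>[x, 2 x]\<close>. The estimates in terms of \<open>F\<close> come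
  from \<open>\<bar>F\<bar> - 2 x \<le> \<bar>F - e\<bar> \<le> \<bar>F\<bar> + 2 x\<close>, the uniform bound comes from \<open>prod_dist_points_ge\<close>. The
  limit over \<open>n\<close> is taken because for a fixed \<open>n\<close> the values of \<open>F\<close> may come arbitrarily close to one
  of the points, in which case the reciprocal of that geometric mean is unbounded.\<close>

lemma holomorphic_of_size_near_circle:
  assumes F: "F holomorphic_on ball 0 1" and x: "x > 0"
    and E: "closed E" "E \<inter> F ` ball 0 1 = {}"
    and circles: "\<And>s. x \<le> s \<Longrightarrow> s \<le> 2 * x \<Longrightarrow> \<exists>e\<in>E. cmod e = s"
  obtains f where "f holomorphic_on ball 0 1"
    and "\<And>z. z \<in> ball 0 1 \<Longrightarrow> cmod (f z) \<le> 4 * exp 1 / x"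
    and "\<And>z. z \<in> ball 0 1 \<Longrightarrow> 1 / (cmod (F z) + 2 * x) \<le> cmod (f z)"
    and "\<And>z. z \<in> ball 0 1 \<Longrightarrow> 2 * x < cmod (F z) \<Longrightarrow> cmod (f z) \<le> 1 / (cmod (F z) - 2 * x)"
proof -
  obtain p where p: "\<And>s. x \<le> s \<Longrightarrow> s \<le> 2 * x \<Longrightarrow> p s \<in> E \<and> cmod (p s) = s"
    using circles by metis
  \<comment> \<open>\<open>Suc n\<close> factors are used throughout, which avoids the empty product.\<close>
  define e where "e = (\<lambda>n i. p (x * (1 + real i / real (Suc n))))"
  have e: "e n i \<in> E" "cmod (e n i) = x * (1 + real i / real (Suc n))" "cmod (e n i) \<le> 2 * x"
    if "i < Suc n" for n i
  proof -
    have "x * (1 + real i / real (Suc n)) \<le> x * (1 + 1)"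
      using x that by (intro mult_left_mono add_left_mono) auto
    moreover have "x * 1 \<le> x * (1 + real i / real (Suc n))"
      using x by (intro mult_left_mono) auto
    ultimately show "e n i \<in> E" "cmod (e n i) = x * (1 + real i / real (Suc n))" "cmod (e n i) \<le> 2 * x"
      unfolding e_def using p[of "x * (1 + real i / real (Suc n))"] by auto
  qed
  define P where "P = (\<lambda>n z. \<Prod>i<Suc n. F z - e n i)"
  have normP: "cmod (P n z) = (\<Prod>i<Suc n. cmod (F z - e n i))" for n z
    by (simp only: P_def prod_norm)
  have "F z - e n i \<noteq> 0" if "z \<in> ball 0 1" "i < Suc n" for z n i
    using E(2) e(1)[OF that(2)] that(1) by (metis disjoint_iff eq_iff_diff_eq_0 imageI)
  then have P0: "P n z \<noteq> 0" if "z \<in> ball 0 1" for n z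
    using that by (auto simp: P_def simp del: prod.lessThan_Suc)
  have "\<exists>f. f holomorphic_on ball 0 1 \<and> (\<forall>z \<in> ball 0 1. cmod (f z) ^ Suc n * cmod (P n z) = 1)" for n
    by (rule norm_holomorphic_root[of "P n" "Suc n"])
       (use P0 in \<open>auto simp: P_def simp del: prod.lessThan_Suc power_Suc intro!: holomorphic_intros F\<close>)
  then obtain f where f: "\<And>n. f n holomorphic_on ball 0 1"
      "\<And>n z. z \<in> ball 0 1 \<Longrightarrow> cmod (f n z) ^ Suc n * cmod (P n z) = 1"
    by metis
  have upper: "cmod (f n z) \<le> 1 / b" if "z \<in> ball 0 1" "b > 0" "b ^ Suc n \<le> cmod (P n z)" for n z b
  proof (rule power_le_imp_le_base)
    have "cmod (f n z) ^ Suc n * b ^ Suc n \<le> 1"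
      unfolding f(2)[OF that(1), of n, symmetric] by (intro mult_left_mono that) auto
    then show "cmod (f n z) ^ Suc n \<le> (1 / b) ^ Suc n"
      using that(2) by (simp only: power_divide power_one pos_le_divide_eq zero_less_power)
  qed (use that in auto)
  have far: "\<exists>\<delta>>0. \<forall>z\<in>K. \<forall>n. \<forall>i<Suc n. \<delta> \<le> cmod (F z - e n i)" if K: "compact K" "K \<subseteq> ball 0 1" for K
  proof -
    have "compact (F ` K)"
      using F K by (intro compact_continuous_image holomorphic_on_imp_continuous_on)
        (auto elim: holomorphic_on_subset)
    then obtain \<delta> where "\<delta> > 0" "\<forall>w\<in>F ` K. \<forall>y\<in>E. \<delta> \<le> dist w y"
      using separate_compact_closed[of "F ` K" E] E K(2) by blast
    then show ?thesis using e(1) by (auto simp: dist_norm)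
  qed
  \<comment> \<open>On a compact set every factor is at least the distance \<open>\<delta>\<close> to \<open>E\<close>, whatever \<open>n\<close> is.\<close>
  obtain g r where g: "g holomorphic_on ball 0 1" and r: "strict_mono r"
    and lim: "\<And>z. z \<in> ball 0 1 \<Longrightarrow> (\<lambda>n. f (r n) z) \<longlonglongrightarrow> g z"
  proof (rule Montel[of "ball 0 1" "range f" f])
    show "\<exists>B. \<forall>h\<in>range f. \<forall>z\<in>K. cmod (h z) \<le> B" if K: "compact K" "K \<subseteq> ball 0 1" for K
    proof -
      obtain \<delta> where \<delta>: "\<delta> > 0" "\<forall>z\<in>K. \<forall>n. \<forall>i<Suc n. \<delta> \<le> cmod (F z - e n i)"
        using far[OF K] by blast
      have "cmod (f n z) \<le> 1 / \<delta>" if "z \<in> K" for n z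
      proof (rule upper)
        have "(\<Prod>i<Suc n. \<delta>) \<le> cmod (P n z)"
          unfolding normP using \<delta> that by (intro prod_mono) auto
        then show "\<delta> ^ Suc n \<le> cmod (P n z)" by simp
      qed (use \<delta> K that in auto)
      then show ?thesis by blast
    qed
  qed (use f in auto)
  have nlim: "(\<lambda>n. cmod (f (r n) z)) \<longlonglongrightarrow> cmod (g z)" if "z \<in> ball 0 1" for z
    by (intro tendsto_norm lim that)
  show ?thesis
  proof
    fix z :: complex assume z: "z \<in> ball 0 1"
    obtain \<delta> where \<delta>: "\<delta> > 0" "\<And>n i. i < Suc n \<Longrightarrow> \<delta> \<le> cmod (F z - e n i)"
      using far[of "{z}"] z by (auto simp del: All_less_Suc)
    \<comment> \<open>The \<open>n\<close>-th root of \<open>\<delta> / x\<close> tends to 1, so the dependence of the bound on \<open>z\<close> is lost in the limit.\<close>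
    have fz: "cmod (f n z) \<le> 1 / (root (Suc n) (\<delta> / x) * (x / (4 * exp 1)))" for n
    proof (rule upper[OF z])
      have "(root (Suc n) (\<delta> / x) * (x / (4 * exp 1))) ^ Suc n = \<delta> / x * (x / (4 * exp 1)) ^ Suc n"
        using \<delta> x by (simp only: power_mult_distrib real_root_pow_pos2 divide_nonneg_nonneg less_imp_le zero_less_Suc)
      also have "\<dots> \<le> cmod (P n z)"
        unfolding normP by (rule prod_dist_points_ge) (use x \<delta> e in auto)
      finally show "(root (Suc n) (\<delta> / x) * (x / (4 * exp 1))) ^ Suc n \<le> cmod (P n z)" .
    qed (use \<delta> x in auto)
    have "(\<lambda>n. 1 / (root n (\<delta> / x) * (x / (4 * exp 1)))) \<longlonglongrightarrow> 1 / (1 * (x / (4 * exp 1)))"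
      using \<delta> x by (intro tendsto_intros LIMSEQ_root_const) auto
    then have "(\<lambda>n. 1 / (root (Suc n) (\<delta> / x) * (x / (4 * exp 1)))) \<longlonglongrightarrow> 1 / (1 * (x / (4 * exp 1)))"
      by (rule LIMSEQ_Suc)
    from LIMSEQ_subseq_LIMSEQ[OF this r]
    have "(\<lambda>n. 1 / (root (Suc (r n)) (\<delta> / x) * (x / (4 * exp 1)))) \<longlonglongrightarrow> 4 * exp 1 / x"
      by (simp add: o_def)
    then show "cmod (g z) \<le> 4 * exp 1 / x"
      by (rule LIMSEQ_le[OF nlim[OF z]]) (use fz in blast)
    show "1 / (cmod (F z) + 2 * x) \<le> cmod (g z)"
    proof (rule LIMSEQ_le_const[OF nlim[OF z]], intro exI allI impI)
      fix n
      let ?N = "Suc (r n)" and ?b = "cmod (F z) + 2 * x"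
      have b: "?b > 0" using x by (simp add: add_nonneg_pos)
      have "cmod (P (r n) z) \<le> (\<Prod>i<?N. ?b)"
        unfolding normP
      proof (rule prod_mono)
        fix i assume "i \<in> {..<?N}"
        then show "0 \<le> cmod (F z - e (r n) i) \<and> cmod (F z - e (r n) i) \<le> ?b"
          using e(3)[of i "r n"] norm_triangle_ineq4[of "F z" "e (r n) i"] by auto
      qed
      then have "1 \<le> cmod (f (r n) z) ^ ?N * ?b ^ ?N"
        unfolding f(2)[OF z, of "r n", symmetric] by (intro mult_left_mono) auto
      then have "(1 / ?b) ^ ?N \<le> cmod (f (r n) z) ^ ?N"
        using b by (simp only: power_divide power_one pos_divide_le_eq zero_less_power)
      then show "1 / ?b \<le> cmod (f (r n) z)"
        by (rule power_le_imp_le_base) auto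
    qed
    show "cmod (g z) \<le> 1 / (cmod (F z) - 2 * x)" if big: "2 * x < cmod (F z)"
    proof (rule LIMSEQ_le_const2[OF nlim[OF z]], intro exI allI impI)
      fix n
      show "cmod (f (r n) z) \<le> 1 / (cmod (F z) - 2 * x)"
      proof (rule upper[OF z])
        have "(\<Prod>i<Suc (r n). cmod (F z) - 2 * x) \<le> cmod (P (r n) z)"
          unfolding normP
        proof (rule prod_mono)
          fix i assume "i \<in> {..<Suc (r n)}"
          then show "0 \<le> cmod (F z) - 2 * x \<and> cmod (F z) - 2 * x \<le> cmod (F z - e (r n) i)"
            using e(3)[of i "r n"] norm_triangle_ineq2[of "F z" "e (r n) i"] big by auto
        qed
        then show "(cmod (F z) - 2 * x) ^ Suc (r n) \<le> cmod (P (r n) z)" by simp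
      qed (use big in auto)
    qed
  qed (rule g)
qed

text \<open>Bounded convergence on the disc implies weak convergence in the Hardy space, so the constant 1 is a
  weak limit of multiples of \<open>F\<close> with bounded analytic multipliers. For bounded \<open>F\<close> it makes
  the multiples of \<open>F\<close> dense in the Hardy space, which by Beurling's theorem means that \<open>F\<close> is outer.\<close>

definition approximately_invertible :: "(complex \<Rightarrow> complex) \<Rightarrow> bool" where
  "approximately_invertible F \<longleftrightarrow> (\<exists>f B.
     (\<forall>n. f n holomorphic_on ball 0 1 \<and> bounded (f n ` ball 0 1)) \<and>
     (\<forall>n. \<forall>z\<in>ball 0 1. cmod (F z * f n z) \<le> B) \<and>
     (\<forall>K. compact K \<and> K \<subseteq> ball 0 1 \<longrightarrow> uniform_limit K (\<lambda>n z. F z * f n z) (\<lambda>z. 1) sequentially))"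

lemma approximately_invertible_bounded_below:
  assumes F: "F holomorphic_on ball 0 1" and d: "d > 0" "\<And>z. z \<in> ball 0 1 \<Longrightarrow> d \<le> cmod (F z)"
  shows "approximately_invertible F"
proof -
  have nz: "F z \<noteq> 0" if "z \<in> ball 0 1" for z using d(2)[OF that] d(1) by auto
  have "bounded ((\<lambda>z. 1 / F z) ` ball 0 1)"
    unfolding bounded_iff
    by (intro exI[of _ "1 / d"]) (use d in \<open>auto simp: norm_divide intro!: frac_le\<close>)
  moreover have "(\<lambda>z. 1 / F z) holomorphic_on ball 0 1"
    using nz by (intro holomorphic_intros F) auto
  moreover have "uniform_limit K (\<lambda>n z. F z * (1 / F z)) (\<lambda>z. 1) sequentially" if "K \<subseteq> ball 0 1" for K
    by (rule uniform_limitI) (use nz that in auto)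
  ultimately show ?thesis
    unfolding approximately_invertible_def
    by (intro exI[of _ "\<lambda>n z. 1 / F z"] exI[of _ 1]) (use nz in auto)
qed

text \<open>Let \<open>f\<close> be as in \<open>holomorphic_of_size_near_circle\<close>, with \<open>x\<close> tending to 0. Then \<open>F f\<close> is bounded by \<open>16 e\<close>: use
  \<open>\<bar>f\<bar> \<le> 4 e / x\<close> where \<open>\<bar>F\<bar> \<le> 4 x\<close> and \<open>\<bar>f\<bar> \<le> 1 / (\<bar>F\<bar> - 2 x)\<close> elsewhere. Multiplied by unimodular
  constants so as to be nonnegative at the origin, these functions form a normal family; a limit has
  modulus 1 everywhere and value 1 at the origin, so it is 1.\<close>

lemma approximately_invertible_if_circles_met:
  assumes F: "F holomorphic_on ball 0 1" and nz: "\<And>z. z \<in> ball 0 1 \<Longrightarrow> F z \<noteq> 0"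
    and E: "closed E" "E \<inter> F ` ball 0 1 = {}" and d: "d > 0"
    and circles: "\<And>s. 0 < s \<Longrightarrow> s \<le> d \<Longrightarrow> \<exists>e\<in>E. cmod e = s"
  shows "approximately_invertible F"
proof -
  \<comment> \<open>The factor 2 keeps the whole range \<open>[x, 2 x]\<close> of moduli below \<open>d\<close>.\<close>
  define x where "x = (\<lambda>n. d / (2 * real (Suc n)))"
  have x0: "x n > 0" for n using d by (simp add: x_def)
  have xd: "2 * x n \<le> d" for n using d by (simp add: x_def field_simps)
  have xlim: "x \<longlonglongrightarrow> 0"
    unfolding x_def using LIMSEQ_Suc[OF lim_const_over_n[of "d / 2"]] by simp
  have "\<exists>f. f holomorphic_on ball 0 1 \<and> (\<forall>z\<in>ball 0 1. cmod (f z) \<le> 4 * exp 1 / x n \<and>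
      1 / (cmod (F z) + 2 * x n) \<le> cmod (f z) \<and>
      (2 * x n < cmod (F z) \<longrightarrow> cmod (f z) \<le> 1 / (cmod (F z) - 2 * x n)))" for n
  proof (rule holomorphic_of_size_near_circle[OF F x0[of n] E])
    show "\<exists>e\<in>E. cmod e = s" if "x n \<le> s" "s \<le> 2 * x n" for s
      using circles[of s] x0[of n] xd[of n] that by linarith
  qed blast
  then obtain f where f: "\<And>n. f n holomorphic_on ball 0 1"
    and f1: "\<And>n z. z \<in> ball 0 1 \<Longrightarrow> cmod (f n z) \<le> 4 * exp 1 / x n"
    and f2: "\<And>n z. z \<in> ball 0 1 \<Longrightarrow> 1 / (cmod (F z) + 2 * x n) \<le> cmod (f n z)"
    and f3: "\<And>n z. z \<in> ball 0 1 \<Longrightarrow> 2 * x n < cmod (F z) \<Longrightarrow> cmod (f n z) \<le> 1 / (cmod (F z) - 2 * x n)"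
    by metis
  have bound: "cmod (F z * f n z) \<le> 16 * exp 1" if z: "z \<in> ball 0 1" for n z
  proof (cases "cmod (F z) \<le> 4 * x n")
    case True
    have "cmod (F z) * cmod (f n z) \<le> (4 * x n) * (4 * exp 1 / x n)"
      using True x0[of n] by (intro mult_mono f1 z) auto
    then show ?thesis using x0[of n] by (simp add: norm_mult)
  next
    case False
    have "cmod (F z) * cmod (f n z) \<le> cmod (F z) * (1 / (cmod (F z) - 2 * x n))"
      using False x0[of n] by (intro mult_left_mono f3 z) auto
    also have "\<dots> \<le> 2" using False x0[of n] by (simp add: field_simps)
    also have "\<dots> \<le> 16 * exp 1" using exp_ge_add_one_self[of 1] by simp
    finally show ?thesis by (simp add: norm_mult)
  qed
  have "\<exists>u. cmod u = 1 \<and> u * w = of_real (cmod w)" for w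
  proof (cases "w = 0")
    case False
    then show ?thesis
      by (intro exI[of _ "cnj w / of_real (cmod w)"])
         (simp add: norm_divide complex_norm_square[symmetric] power2_eq_square mult.commute[of "cnj w"])
  qed (auto intro: exI[of _ 1])
  then have "\<exists>u. cmod u = 1 \<and> u * (F 0 * f n 0) = of_real (cmod (F 0 * f n 0))" for n
    by blast
  then obtain u where u: "\<And>n. cmod (u n) = 1" "\<And>n. u n * (F 0 * f n 0) = of_real (cmod (F 0 * f n 0))"
    by metis
  define h where "h = (\<lambda>n z. F z * (u n * f n z))"
  have normh: "cmod (h n z) = cmod (F z * f n z)" for n z by (simp add: h_def norm_mult u)
  have lim1: "(\<lambda>n. cmod (h n z)) \<longlonglongrightarrow> 1" if z: "z \<in> ball 0 1" for z
  proof (rule tendsto_sandwich)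
    let ?c = "cmod (F z)"
    have c: "?c > 0" using nz[OF z] by simp
    show "\<forall>\<^sub>F n in sequentially. ?c * (1 / (?c + 2 * x n)) \<le> cmod (h n z)"
      unfolding normh norm_mult by (intro always_eventually allI mult_left_mono f2 z) auto
    have "(\<lambda>n. 2 * x n) \<longlonglongrightarrow> 2 * 0" by (intro tendsto_intros xlim)
    from order_tendstoD(2)[OF this, of ?c]
    have "\<forall>\<^sub>F n in sequentially. 2 * x n < ?c" using c by simp
    then show "\<forall>\<^sub>F n in sequentially. cmod (h n z) \<le> ?c * (1 / (?c - 2 * x n))"
      unfolding normh norm_mult by eventually_elim (intro mult_left_mono f3 z, auto)
    have "(\<lambda>n. ?c * (1 / (?c + 2 * x n))) \<longlonglongrightarrow> ?c * (1 / (?c + 2 * 0))"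
      using c by (intro tendsto_intros xlim) auto
    then show "(\<lambda>n. ?c * (1 / (?c + 2 * x n))) \<longlonglongrightarrow> 1" using c by simp
    have "(\<lambda>n. ?c * (1 / (?c - 2 * x n))) \<longlonglongrightarrow> ?c * (1 / (?c - 2 * 0))"
      using c by (intro tendsto_intros xlim) auto
    then show "(\<lambda>n. ?c * (1 / (?c - 2 * x n))) \<longlonglongrightarrow> 1" using c by simp
  qed
  obtain g r where g: "g holomorphic_on ball 0 1" and r: "strict_mono r"
    and lim: "\<And>z. z \<in> ball 0 1 \<Longrightarrow> (\<lambda>n. h (r n) z) \<longlonglongrightarrow> g z"
    and ulim: "\<And>K. compact K \<Longrightarrow> K \<subseteq> ball 0 1 \<Longrightarrow> uniform_limit K (h \<circ> r) g sequentially"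
  proof (rule Montel[of "ball 0 1" "range h" h])
    show "\<exists>B. \<forall>w\<in>range h. \<forall>z\<in>K. cmod (w z) \<le> B" if "compact K" "K \<subseteq> ball 0 1" for K
      using bound that by (intro exI[of _ "16 * exp 1"]) (auto simp: normh)
  qed (auto simp: h_def intro!: holomorphic_intros F f)
  have norm1: "cmod (g z) = 1" if z: "z \<in> ball 0 1" for z
    using LIMSEQ_unique[OF tendsto_norm[OF lim[OF z]] LIMSEQ_subseq_LIMSEQ[OF lim1[OF z] r, unfolded o_def]] .
  have h0: "h n 0 = of_real (cmod (h n 0))" for n
    using u(2)[of n] unfolding normh by (simp add: h_def mult_ac)
  have "(\<lambda>n. of_real (cmod (h (r n) 0))) \<longlonglongrightarrow> complex_of_real (cmod (g 0))"
    by (intro tendsto_intros lim) auto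
  moreover have "(\<lambda>n. of_real (cmod (h (r n) 0))) = (\<lambda>n. h (r n) 0)"
    by (intro ext h0[symmetric])
  ultimately have "(\<lambda>n. h (r n) 0) \<longlonglongrightarrow> complex_of_real (cmod (g 0))" by (simp only:)
  from LIMSEQ_unique[OF lim this] have "g 0 = of_real (cmod (g 0))" by simp
  then have g0: "g 0 = 1" using norm1[of 0] by simp
  have "g constant_on ball 0 1"
    by (rule maximum_modulus_principle[OF g open_ball connected_ball open_ball order_refl, of 0])
       (use norm1 in auto)
  then have g1: "g z = 1" if "z \<in> ball 0 1" for z
    using g0 that unfolding constant_on_def by (metis centre_in_ball zero_less_one)
  show ?thesis
    unfolding approximately_invertible_def
  proof (intro exI[of _ "\<lambda>n z. u (r n) * f (r n) z"] exI[of _ "16 * exp 1"] conjI allI ballI impI)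
    fix n
    show "(\<lambda>z. u (r n) * f (r n) z) holomorphic_on ball 0 1" by (intro holomorphic_intros f)
    show "bounded ((\<lambda>z. u (r n) * f (r n) z) ` ball 0 1)"
      unfolding bounded_iff using f1[of _ "r n"] by (intro exI[of _ "4 * exp 1 / x (r n)"]) (auto simp: norm_mult u)
    show "cmod (F z * (u (r n) * f (r n) z)) \<le> 16 * exp 1" if "z \<in> ball 0 1" for z
      using bound[OF that] normh[of "r n" z] by (simp add: h_def)
  next
    fix K :: "complex set" assume K: "compact K \<and> K \<subseteq> ball 0 1"
    show "uniform_limit K (\<lambda>n z. F z * (u (r n) * f (r n) z)) (\<lambda>z. 1) sequentially"
      by (rule uniform_limit_cong'[THEN iffD1, OF _ _ ulim[of K]]) (use K g1 in \<open>auto simp: h_def\<close>)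
  qed
qed

section \<open>Functionals that vanish on multiples\<close>

text \<open>Extension by 0 turns an analytic function on the disc into a candidate for \<^const>\<open>hardy2\<close>.\<close>

definition on_disc :: "(complex \<Rightarrow> complex) \<Rightarrow> complex \<Rightarrow> complex" where
  "on_disc g = (\<lambda>z. if cmod z < 1 then g z else 0)"

lemma on_disc_bounded_hardy2:
  assumes g: "g holomorphic_on ball 0 1" and B: "\<And>z. z \<in> ball 0 1 \<Longrightarrow> cmod (g z) \<le> B"
  shows "on_disc g \<in> hardy2" and "hardy2_norm (on_disc g) \<le> B"
proof -
  have B0: "B \<ge> 0" using B[of 0] by (meson centre_in_ball norm_ge_zero order_trans zero_less_one)
  have mean: "circle_mean2 (on_disc g) r \<le> B\<^sup>2" if r: "r \<in> {0..<1}" for r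
  proof -
    have in_disc: "of_real r * cis t \<in> ball 0 1" for t using r by (simp add: norm_mult)
    have "continuous_on {0..2*pi} (\<lambda>t. g (of_real r * cis t))"
      by (rule continuous_on_compose2[OF holomorphic_on_imp_continuous_on[OF g]])
         (use in_disc in \<open>auto intro!: continuous_intros\<close>)
    then have "(\<lambda>t. (cmod (g (of_real r * cis t)))\<^sup>2) integrable_on {0..2*pi}"
      by (intro integrable_continuous_interval continuous_intros)
    then have "integral {0..2*pi} (\<lambda>t. (cmod (g (of_real r * cis t)))\<^sup>2) \<le> integral {0..2*pi} (\<lambda>t. B\<^sup>2)"
      by (rule integral_le) (use B in_disc in \<open>auto intro!: power_mono\<close>)
    then show ?thesis
      using in_disc by (simp add: circle_mean2_def on_disc_def divide_le_eq mult.commute)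
  qed
  have holo: "on_disc g holomorphic_on ball 0 1"
    by (rule holomorphic_transform[OF g]) (simp add: on_disc_def)
  show "on_disc g \<in> hardy2"
    using holo mean by (auto simp: hardy2_def on_disc_def intro!: bdd_aboveI2[where M = "B\<^sup>2"])
  have "(SUP r\<in>{0..<1}. circle_mean2 (on_disc g) r) \<le> B\<^sup>2"
    using mean by (intro cSUP_least) auto
  then show "hardy2_norm (on_disc g) \<le> B"
    using B0 unfolding hardy2_norm_def by (rule real_le_lsqrt[rotated 1])
qed

lemma monomial_eq: "monomial k = on_disc (\<lambda>z. z ^ k)"
proof
  fix z :: complex
  have "(\<Sum>n. (if n = k then 1 else 0) * z ^ n) = (\<Sum>n\<in>{k}. (if n = k then 1 else 0) * z ^ n)"
    by (rule suminf_finite) auto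
  then show "monomial k z = on_disc (\<lambda>z. z ^ k) z"
    by (simp add: monomial_def disc_series_def on_disc_def)
qed

text \<open>For each \<open>k\<close> the functions \<open>F h\<^sub>n z\<^sup>k\<close> are killed by \<open>L\<close> and tend weakly to \<open>z\<^sup>k\<close>, so \<open>L\<close> kills
  the monomials, which span a dense subspace.\<close>

lemma functional_zero_if_zero_on_multiples:
  assumes L: "hardy2_functional L"
    and F: "F holomorphic_on ball 0 1" "approximately_invertible F"
    and zero: "\<And>g. g holomorphic_on ball 0 1 \<Longrightarrow> bounded (g ` ball 0 1) \<Longrightarrow> L (on_disc (\<lambda>z. F z * g z)) = 0"
    and f: "f \<in> hardy2"
  shows "L f = 0"
proof -
  obtain h B where hB: "\<forall>n. h n holomorphic_on ball 0 1 \<and> bounded (h n ` ball 0 1)"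
      "\<forall>n. \<forall>z\<in>ball 0 1. cmod (F z * h n z) \<le> B"
    and ulim: "\<forall>K. compact K \<and> K \<subseteq> ball 0 1 \<longrightarrow>
      uniform_limit K (\<lambda>n z. F z * h n z) (\<lambda>z. 1) sequentially"
    using F(2) unfolding approximately_invertible_def by (elim exE conjE) (rule that)
  have h: "h n holomorphic_on ball 0 1" "bounded (h n ` ball 0 1)" for n
    using hB(1) by auto
  have B: "cmod (F z * h n z) \<le> B" if "z \<in> ball 0 1" for n z
    using hB(2) that by blast
  have "L (monomial k) = 0" for k
  proof -
    define v where "v = (\<lambda>n. on_disc (\<lambda>z. F z * (h n z * z ^ k)))"
    have le1: "cmod z ^ k \<le> 1" if "z \<in> ball 0 1" for z :: complex
      using that by (intro power_le_one) auto
    have B': "cmod (F z * (h n z * z ^ k)) \<le> B" if z: "z \<in> ball 0 1" for n z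
    proof -
      have "cmod (F z * h n z) * cmod z ^ k \<le> cmod (F z * h n z) * 1"
        by (intro mult_left_mono le1 z) auto
      also have "\<dots> \<le> B" using B[OF z, of n] by simp
      finally show ?thesis by (simp add: norm_mult norm_power mult.assoc)
    qed
    have v: "v n \<in> hardy2" "hardy2_norm (v n) \<le> B" for n
    proof -
      have holo: "(\<lambda>z. F z * (h n z * z ^ k)) holomorphic_on ball 0 1"
        by (intro holomorphic_intros F h)
      show "v n \<in> hardy2" "hardy2_norm (v n) \<le> B"
        unfolding v_def
        by (rule on_disc_bounded_hardy2(1)[OF holo B'], assumption)
           (rule on_disc_bounded_hardy2(2)[OF holo B'], assumption)
    qed
    have "bounded ((\<lambda>z. h n z * z ^ k) ` ball 0 1)" for n
    proof -
      obtain C where C: "\<And>z. z \<in> ball 0 1 \<Longrightarrow> cmod (h n z) \<le> C"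
        using h(2)[of n] unfolding bounded_iff by blast
      have "cmod (h n z * z ^ k) \<le> C" if z: "z \<in> ball 0 1" for z
        using mult_left_mono[OF le1[OF z], of "cmod (h n z)"] C[OF z] by (simp add: norm_mult norm_power)
      then show ?thesis unfolding bounded_iff by blast
    qed
    then have Lv: "L (v n) = 0" for n
      unfolding v_def by (intro zero holomorphic_intros h)
    have mon: "monomial k \<in> hardy2"
      unfolding monomial_eq by (rule on_disc_bounded_hardy2[of _ 1]) (use le1 in \<open>auto simp: norm_power intro!: holomorphic_intros\<close>)
    have lim: "(\<lambda>n. taylor_coeff (v n) j) \<longlonglongrightarrow> taylor_coeff (monomial k) j" for j
      unfolding taylor_coeff_def
    proof (intro tendsto_divide tendsto_const higher_deriv_complex_uniform_limit[where A = "ball 0 (1/2)"])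
      have "uniform_limit (cball 0 (1/2)) (\<lambda>n z. F z * h n z * z ^ k) (\<lambda>z. 1 * z ^ k) sequentially"
        by (intro uniform_lim_mult ulim[rule_format] conjI uniform_limit_const compact_imp_bounded compact_continuous_image continuous_intros) auto
      then have "uniform_limit (ball 0 (1/2)) (\<lambda>n z. F z * h n z * z ^ k) (\<lambda>z. 1 * z ^ k) sequentially"
        by (rule uniform_limit_on_subset) auto
      then show "uniform_limit (ball 0 (1/2)) v (monomial k) sequentially"
        by (rule uniform_limit_cong'[THEN iffD1, rotated -1]) (auto simp: v_def monomial_eq on_disc_def)
      show "\<forall>\<^sub>F n in sequentially. v n holomorphic_on ball 0 (1/2)"
        using v(1) by (intro always_eventually allI holomorphic_on_subset[of _ "ball 0 1" "ball 0 (1/2)"]) (auto simp: hardy2_def)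
    qed auto
    have "(\<Sum>j. (cmod (taylor_coeff (v n) j))\<^sup>2) \<le> B\<^sup>2" for n
    proof -
      have "sqrt (\<Sum>j. (cmod (taylor_coeff (v n) j))\<^sup>2) \<le> B"
        using disc_series_hardy2(2)[OF hardy2_eq_disc_series(1)[OF v(1)[of n]]]
          hardy2_eq_disc_series(2)[OF v(1)[of n]] v(2)[of n] by simp
      then show ?thesis by (rule sqrt_le_D)
    qed
    from functional_weak_limit[OF L hardy2_eq_disc_series(1)[OF v(1)] this lim hardy2_eq_disc_series(1)[OF mon]]
    have "(\<lambda>n. L (v n)) \<longlonglongrightarrow> L (monomial k)"
      using hardy2_eq_disc_series(2)[OF v(1)] hardy2_eq_disc_series(2)[OF mon] by simp
    then show ?thesis by (simp add: Lv LIMSEQ_const_iff)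
  qed
  then show ?thesis
    using functional_disc_series_sums[OF L hardy2_eq_disc_series(1)[OF f]] hardy2_eq_disc_series(2)[OF f]
      sums_unique2[OF sums_zero] by simp
qed


section \<open>Intertwining operators\<close>

lemma evaluation_functional:
  assumes X: "hardy2_bounded_operator X" and a: "cmod a < 1"
  shows "hardy2_functional (\<lambda>f. X f a)"
proof -
  obtain K where K: "\<And>f. f \<in> hardy2 \<Longrightarrow> hardy2_norm (X f) \<le> K * hardy2_norm f"
    using X unfolding hardy2_bounded_operator_def by blast
  have "cmod (X f a) \<le> K / (1 - cmod a) * hardy2_norm f" if f: "f \<in> hardy2" for f
  proof -
    have Xf: "X f \<in> hardy2" using X f unfolding hardy2_bounded_operator_def by blast
    note c = hardy2_eq_disc_series[OF Xf]
    have "cmod (X f a) \<le> hardy2_norm (X f) / (1 - cmod a)"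
      using norm_disc_series_le[OF c(1) a] disc_series_hardy2(2)[OF c(1)] c(2) by simp
    also have "\<dots> \<le> K * hardy2_norm f / (1 - cmod a)"
      using K[OF f] a by (intro divide_right_mono) auto
    finally show ?thesis by simp
  qed
  moreover have "X (\<lambda>z. f z + g z) a = X f a + X g a" if "f \<in> hardy2" "g \<in> hardy2" for f g
    using X that unfolding hardy2_bounded_operator_def by (simp add: fun_eq_iff)
  moreover have "X (\<lambda>z. c * f z) a = c * X f a" if "f \<in> hardy2" for f c
    using X that unfolding hardy2_bounded_operator_def by (simp add: fun_eq_iff)
  ultimately show ?thesis
    unfolding hardy2_functional_def by blast
qed

text \<open>By the intertwining relation, evaluation of \<open>X\<close> at \<open>a\<close> kills every multiple of \<open>\<phi> - \<psi> a\<close>.\<close>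

lemma intertwiner_vanishes_at:
  assumes X: "hardy2_bounded_operator X"
    and inter: "\<And>f. f \<in> hardy2 \<Longrightarrow> X (toeplitz \<phi> f) = toeplitz \<psi> (X f)"
    and \<phi>: "\<phi> holomorphic_on ball 0 1" "bounded (\<phi> ` ball 0 1)" and a: "cmod a < 1"
    and inv: "approximately_invertible (\<lambda>z. \<phi> z - \<psi> a)"
    and f: "f \<in> hardy2"
  shows "X f a = 0"
proof (rule functional_zero_if_zero_on_multiples[OF evaluation_functional[OF X a] _ inv _ f])
  show "(\<lambda>z. \<phi> z - \<psi> a) holomorphic_on ball 0 1" by (intro holomorphic_intros \<phi>)
  fix g assume g: "g holomorphic_on ball 0 1" "bounded (g ` ball 0 1)"
  obtain C where C: "\<And>z. z \<in> ball 0 1 \<Longrightarrow> cmod (g z) \<le> C"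
    using g(2) unfolding bounded_iff by blast
  obtain M where M: "\<And>z. z \<in> ball 0 1 \<Longrightarrow> cmod (\<phi> z) \<le> M"
    using \<phi>(2) unfolding bounded_iff by blast
  have G: "on_disc g \<in> hardy2" by (rule on_disc_bounded_hardy2[OF g(1) C])
  have "cmod (\<phi> z * g z) \<le> M * C" if "z \<in> ball 0 1" for z
    using M[OF that] C[OF that] by (simp add: norm_mult mult_mono')
  then have "on_disc (\<lambda>z. \<phi> z * g z) \<in> hardy2"
    by (intro on_disc_bounded_hardy2 holomorphic_intros \<phi> g)
  then have P: "toeplitz \<phi> (on_disc g) \<in> hardy2"
    by (simp add: toeplitz_def on_disc_def if_distrib cong: if_cong)
  have Q: "(\<lambda>z. - \<psi> a * on_disc g z) \<in> hardy2"
  proof -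
    have "on_disc (\<lambda>z. - \<psi> a * g z) \<in> hardy2"
      by (rule on_disc_bounded_hardy2[where B = "cmod (\<psi> a) * C"])
         (use C in \<open>auto simp: norm_mult intro!: holomorphic_intros g mult_left_mono\<close>)
    then show ?thesis by (simp add: on_disc_def if_distrib cong: if_cong)
  qed
  have decomp: "on_disc (\<lambda>z. (\<phi> z - \<psi> a) * g z) = (\<lambda>z. toeplitz \<phi> (on_disc g) z + - \<psi> a * on_disc g z)"
    by (auto simp: on_disc_def toeplitz_def algebra_simps)
  have add: "X (\<lambda>z. p z + q z) = (\<lambda>z. X p z + X q z)" if "p \<in> hardy2" "q \<in> hardy2" for p q
    using X that unfolding hardy2_bounded_operator_def by simp
  have "X (on_disc (\<lambda>z. (\<phi> z - \<psi> a) * g z)) =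
      (\<lambda>z. X (toeplitz \<phi> (on_disc g)) z + X (\<lambda>z. - \<psi> a * on_disc g z) z)"
    unfolding decomp by (rule add[OF P Q])
  also have "X (\<lambda>z. - \<psi> a * on_disc g z) = (\<lambda>z. - \<psi> a * X (on_disc g) z)"
    using X G unfolding hardy2_bounded_operator_def by blast
  finally show "X (on_disc (\<lambda>z. (\<phi> z - \<psi> a) * g z)) a = 0"
    using inter[OF G] by (simp add: toeplitz_def)
qed

text \<open>The distance to \<open>c\<close> takes the values 0 and \<open>\<bar>d - c\<bar>\<close> on the connected set \<open>K\<close>, hence also all
  values in between.\<close>

lemma continuum_meets_circles:
  fixes K :: "complex set"
  assumes "connected K" "c \<in> K" "d \<in> K" "0 \<le> s" "s \<le> cmod (d - c)"
  obtains k where "k \<in> K" "cmod (k - c) = s"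
proof -
  have "connected ((\<lambda>k. cmod (k - c)) ` K)"
    by (intro connected_continuous_image continuous_intros assms)
  moreover have "0 \<in> (\<lambda>k. cmod (k - c)) ` K" "cmod (d - c) \<in> (\<lambda>k. cmod (k - c)) ` K"
    using assms by force+
  ultimately have "s \<in> (\<lambda>k. cmod (k - c)) ` K"
    using assms connectedD_interval by blast
  then show ?thesis using that by blast
qed

lemma approximately_invertible_at_continuum:
  assumes \<phi>: "\<phi> holomorphic_on ball 0 1"
    and K: "nondegenerate_continuum K" "K \<inter> \<phi> ` ball 0 1 = {}" and c: "c \<in> K"
  shows "approximately_invertible (\<lambda>z. \<phi> z - c)"
proof -
  have K': "compact K" "connected K" using K by (auto simp: nondegenerate_continuum_def)
  obtain d where d: "d \<in> K" "d \<noteq> c" using K(1) c unfolding nondegenerate_continuum_def by metis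
  show ?thesis
  proof (rule approximately_invertible_if_circles_met[where E = "(\<lambda>k. k - c) ` K" and d = "cmod (d - c)"])
    show "(\<lambda>z. \<phi> z - c) holomorphic_on ball 0 1" by (intro holomorphic_intros \<phi>)
    show "\<phi> z - c \<noteq> 0" if "z \<in> ball 0 1" for z using K(2) c that by auto
    show "closed ((\<lambda>k. k - c) ` K)"
      by (intro compact_imp_closed compact_continuous_image continuous_intros K')
    show "(\<lambda>k. k - c) ` K \<inter> (\<lambda>z. \<phi> z - c) ` ball 0 1 = {}" using K(2) by auto
    show "cmod (d - c) > 0" using d by simp
    show "\<exists>e\<in>(\<lambda>k. k - c) ` K. cmod e = s" if "0 < s" "s \<le> cmod (d - c)" for s
      using continuum_meets_circles[OF K'(2) c d(1), of s] that by (metis imageI less_imp_le)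
  qed
qed

theorem corollary3p3:
  fixes \<phi> \<psi> :: "complex \<Rightarrow> complex"
  assumes "\<phi> holomorphic_on ball 0 1" and "bounded (\<phi> ` ball 0 1)"
    and "\<psi> holomorphic_on ball 0 1" and "bounded (\<psi> ` ball 0 1)"
    and "consists_of_nondegenerate_continua (frontier (\<phi> ` ball 0 1))"
    and "toeplitz \<phi> \<propto> toeplitz \<psi>"
  shows "\<psi> ` ball 0 1 \<subseteq> \<phi> ` ball 0 1"
proof (rule ccontr)
  let ?V = "\<phi> ` ball 0 1"
  assume "\<not> \<psi> ` ball 0 1 \<subseteq> ?V"
  then obtain a0 where a0: "a0 \<in> ball 0 1" "\<psi> a0 \<notin> ?V" by blast
  obtain X f where X: "hardy2_bounded_operator X" "f \<in> hardy2" "X f \<noteq> (\<lambda>z. 0)"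
    and inter: "\<And>f. f \<in> hardy2 \<Longrightarrow> X (toeplitz \<phi> f) = toeplitz \<psi> (X f)"
    using assms(6) unfolding intertwined_def by blast
  have continuum: "\<exists>K. nondegenerate_continuum K \<and> c \<in> K \<and> K \<subseteq> frontier ?V" if "c \<in> frontier ?V" for c
    using assms(5) that unfolding consists_of_nondegenerate_continua_def by (metis UnionE Union_upper)
  have "\<not> \<phi> constant_on ball 0 1"
  proof
    assume "\<phi> constant_on ball 0 1"
    then obtain y where y: "\<And>z. z \<in> ball 0 1 \<Longrightarrow> \<phi> z = y" unfolding constant_on_def by blast
    have "?V = (\<lambda>_::complex. y) ` ball 0 1" by (rule image_cong[OF refl y])
    then have V: "?V = {\<phi> 0}" using y[of 0] by (simp add: image_constant_conv)
    then have "\<phi> 0 \<in> frontier ?V" by (simp add: frontier_def)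
    then show False
      using continuum[of "\<phi> 0"] V by (auto simp: frontier_def nondegenerate_continuum_def)
  qed
  then have openV: "open ?V"
    by (intro open_mapping_thm[OF assms(1)]) auto
  then have frontier_disj: "frontier ?V \<inter> ?V = {}"
    by (auto simp: frontier_def interior_open)
  have vanish: "X f a = 0" if a: "a \<in> ball 0 1" "\<psi> a \<notin> ?V" for a
  proof (rule intertwiner_vanishes_at[OF X(1) inter assms(1,2) _ _ X(2)])
    show "cmod a < 1" using a by simp
    show "approximately_invertible (\<lambda>z. \<phi> z - \<psi> a)"
    proof (cases "\<psi> a \<in> closure ?V")
      case True
      then have "\<psi> a \<in> frontier ?V"
        using a openV by (simp add: frontier_def interior_open)
      then obtain K where "nondegenerate_continuum K" "\<psi> a \<in> K" "K \<subseteq> frontier ?V"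
        using continuum by blast
      then show ?thesis
        using frontier_disj by (intro approximately_invertible_at_continuum[OF assms(1)]) auto
    next
      case False
      then obtain d where d: "d > 0" "ball (\<psi> a) d \<subseteq> - closure ?V"
        using openE[of "- closure ?V" "\<psi> a"] by (auto simp: closed_closure)
      have "d \<le> cmod (\<phi> z - \<psi> a)" if "z \<in> ball 0 1" for z
        using d(2) that closure_subset[of ?V] by (force simp: dist_norm norm_minus_commute subset_iff not_le)
      then show ?thesis
        by (intro approximately_invertible_bounded_below[of _ d] holomorphic_intros assms d) auto
    qed
  qed
  define A where "A = {a \<in> ball 0 1. \<psi> a \<notin> ?V}"
  have "a0 islimpt A"
  proof (cases "\<psi> constant_on ball 0 1")
    case True
    then have "A = ball 0 1" using a0 unfolding A_def constant_on_def by auto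
    then show ?thesis using a0 by (simp add: interior_limit_point)
  next
    case nonconst: False
    show ?thesis
      unfolding islimpt_approachable
    proof (intro allI impI)
      fix \<epsilon> :: real assume \<epsilon>: "\<epsilon> > 0"
      let ?U = "ball a0 \<epsilon> \<inter> ball 0 1"
      have "open (\<psi> ` ?U)"
        by (rule open_mapping_thm[OF assms(3) open_ball connected_ball _ _ nonconst]) auto
      moreover have "\<psi> a0 \<in> \<psi> ` ?U" using a0 \<epsilon> by auto
      \<comment> \<open>A point of the boundary is approached along its continuum, any other point through the interior of the complement.\<close>
      moreover have "\<psi> a0 islimpt - ?V"
      proof (cases "\<psi> a0 \<in> frontier ?V")
        case True
        then obtain K where K: "nondegenerate_continuum K" "\<psi> a0 \<in> K" "K \<subseteq> frontier ?V"
          using continuum by blast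
        then have "\<psi> a0 islimpt K"
          by (intro connected_imp_perfect) (auto simp: nondegenerate_continuum_def)
        then show ?thesis using K(3) frontier_disj by (elim islimpt_subset) auto
      next
        case False
        then have "\<psi> a0 \<in> interior (- ?V)"
          using a0 openV by (simp add: frontier_def interior_open interior_complement)
        then show ?thesis using interior_limit_point interior_subset islimpt_subset by blast
      qed
      ultimately obtain c where "c \<in> - ?V" "c \<in> \<psi> ` ?U" "c \<noteq> \<psi> a0"
        by (metis islimptE)
      then show "\<exists>a\<in>A. a \<noteq> a0 \<and> dist a a0 < \<epsilon>"
        by (auto simp: A_def dist_commute)
    qed
  qed
  moreover have Xf: "X f \<in> hardy2"
    using X(1,2) unfolding hardy2_bounded_operator_def by blast
  ultimately have "X f z = 0" if "z \<in> ball 0 1" for z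
    by (intro analytic_continuation[of "X f" "ball 0 1" A a0 z])
       (use a0 vanish that in \<open>auto simp: A_def hardy2_def\<close>)
  moreover have "X f z = 0" if "z \<notin> ball 0 1" for z
    using Xf that unfolding hardy2_def by blast
  ultimately show False using X(3) by blast
qed

end
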